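(* Let $\alpha\in(0,1)$ be irrational, and let $\widetilde J_0(\cos\pi\alpha)$ be the operator in $\ell^2$ generated by the shifted Darboux transformation at the point $\cos\pi\alpha$ of the Jacobi matrix $J_0$ with zero diagonal, first off-diagonal entry $\frac1{\sqrt2}$ and all other off-diagonal entries $\frac12$. Let $G$ be the associated diagonal sign matrix. Then $$\sigma(\widetilde J_0(\cos\pi\alpha))=\mathbb C,$$ and, thus, the operator $\widetilde J_0(\cos\pi\alpha)$, which is self-adjoint in the Krein space $\ell^2(G)$, is not definitizable.
   Context: All matrices are semi-infinite, indexed by $\{0,1,2,\dots\}$; $\ell^2$ is the Hilbert space of square summable complex sequences. Here $J_0=\begin{pmatrix}0&\frac1{\sqrt2}&0&\cdots\\ \frac1{\sqrt2}&0&\frac12&\\ 0&\frac12&0&\ddots\\ \vdots&&\ddots&\ddots\end{pmatrix}$. Since $\alpha$ is irrational, there is a unique factorization $J_0-\cos\pi\alpha\, I=LGL^{\top}$, where $G=\operatorname{diag}(\varepsilon_0,\varepsilon_1,\dots)$ with $\varepsilon_j\in\{+1,-1\}$ and $L$ is a real lower bidiagonal matrix with positive diagonal entries. The shifted Darboux transformation is the tridiagonal matrix $\widetilde J_0(\cos\pi\alpha)=GL^{\top}L+\cos\pi\alpha\, I$. The operator generated by a tridiagonal matrix in $\ell^2$ (denoted by the same symbol) is the closure of the operator acting by matrix multiplication on finitely supported sequences. The spectrum $\sigma(A)$ and resolvent set $\rho(A)=\mathbb C\setminus\sigma(A)$ of an operator $A$ are taken in $\ell^2$. The Krein space $\ell^2(G)$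 is the linear space $\ell^2$ equipped with the inner product $[f,g]=(Gf,g)_{\ell^2}$. An operator $A$ is self-adjoint in $\ell^2(G)$ (also called $G$-self-adjoint) if $GA$ is self-adjoint in $\ell^2$. A self-adjoint operator $A$ in $\ell^2(G)$, generated by a tridiagonal matrix, is called definitizable if $\rho(A)\neq\emptyset$ and there exists a real polynomial $h\not\equiv0$ such that $[h(A)f,f]\ge0$ for all $f\in\ell^2(G)$ having only a finite number of nonzero entries. *)

theory Defs
  imports
    Complex_Main
    "HOL-Library.Nonpos_Ints"
    "HOL-Computational_Algebra.Polynomial"
begin

section \<open>Semi-infinite matrices\<close>

text \<open>Semi-infinite matrices are functions on \<open>nat \<times> nat\<close>. In every product used below
  each entry is a sum with only finitely many nonzero terms, so \<^const>\<open>suminf\<close> is a finite sum.\<close>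

definition mmult :: "(nat \<Rightarrow> nat \<Rightarrow> real) \<Rightarrow> (nat \<Rightarrow> nat \<Rightarrow> real) \<Rightarrow> nat \<Rightarrow> nat \<Rightarrow> real" where
  "mmult A B = (\<lambda>i j. \<Sum>k. A i k * B k j)"

definition mtranspose :: "(nat \<Rightarrow> nat \<Rightarrow> real) \<Rightarrow> nat \<Rightarrow> nat \<Rightarrow> real" where
  "mtranspose A = (\<lambda>i j. A j i)"

definition mdiag :: "(nat \<Rightarrow> real) \<Rightarrow> nat \<Rightarrow> nat \<Rightarrow> real" where
  "mdiag d = (\<lambda>i j. if i = j then d i else 0)"

definition lower_bidiagonal :: "(nat \<Rightarrow> nat \<Rightarrow> real) \<Rightarrow> bool" where
  "lower_bidiagonal L \<longleftrightarrow> (\<forall>i j. i \<noteq> j \<and> i \<noteq> Suc j \<longrightarrow> L i j = 0)"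

definition tridiagonal :: "(nat \<Rightarrow> nat \<Rightarrow> complex) \<Rightarrow> bool" where
  "tridiagonal T \<longleftrightarrow> (\<forall>i j. i \<noteq> j \<and> i \<noteq> Suc j \<and> j \<noteq> Suc i \<longrightarrow> T i j = 0)"

definition J0 :: "nat \<Rightarrow> nat \<Rightarrow> real" where
  "J0 = (\<lambda>i j. if i = Suc j \<or> j = Suc i then (if i = 0 \<or> j = 0 then 1 / sqrt 2 else 1 / 2) else 0)"

text \<open>\<open>J - c I = L G L\<^sup>T\<close> with \<open>G = mdiag \<epsilon>\<close>.\<close>

definition signed_factorization ::
  "(nat \<Rightarrow> nat \<Rightarrow> real) \<Rightarrow> real \<Rightarrow> (nat \<Rightarrow> nat \<Rightarrow> real) \<Rightarrow> (nat \<Rightarrow> real) \<Rightarrow> bool" where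
  "signed_factorization J c L \<epsilon> \<longleftrightarrow>
     lower_bidiagonal L \<and> (\<forall>j. L j j > 0) \<and> (\<forall>j. \<epsilon> j \<in> {1, -1}) \<and>
     (\<forall>i j. J i j - mdiag (\<lambda>_. c) i j = mmult (mmult L (mdiag \<epsilon>)) (mtranspose L) i j)"

text \<open>\<open>G L\<^sup>T L + c I\<close>\<close>

definition shifted_darboux ::
  "real \<Rightarrow> (nat \<Rightarrow> nat \<Rightarrow> real) \<Rightarrow> (nat \<Rightarrow> real) \<Rightarrow> nat \<Rightarrow> nat \<Rightarrow> real" where
  "shifted_darboux c L \<epsilon> =
     (\<lambda>i j. mmult (mmult (mdiag \<epsilon>) (mtranspose L)) L i j + mdiag (\<lambda>_. c) i j)"


section \<open>The space of square summable sequences\<close>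

definition ell2 :: "(nat \<Rightarrow> complex) set" where
  "ell2 = {f. summable (\<lambda>n. (cmod (f n))\<^sup>2)}"

definition ell2_inner :: "(nat \<Rightarrow> complex) \<Rightarrow> (nat \<Rightarrow> complex) \<Rightarrow> complex" where
  "ell2_inner f g = (\<Sum>n. f n * cnj (g n))"

definition ell2_norm :: "(nat \<Rightarrow> complex) \<Rightarrow> real" where
  "ell2_norm f = sqrt (\<Sum>n. (cmod (f n))\<^sup>2)"

definition finitely_supported :: "(nat \<Rightarrow> complex) set" where
  "finitely_supported = {f. finite {n. f n \<noteq> 0}}"


section \<open>Unbounded operators\<close>

text \<open>An operator in \<^const>\<open>ell2\<close> is given by its graph: \<open>(f, g) \<in> A\<close> means that \<open>f\<close> is in the
  domain of \<open>A\<close> and \<open>A f = g\<close>.\<close>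

type_synonym ell2_op = "((nat \<Rightarrow> complex) \<times> (nat \<Rightarrow> complex)) set"

definition op_closure :: "ell2_op \<Rightarrow> ell2_op" where
  "op_closure A = {(f, g). f \<in> ell2 \<and> g \<in> ell2 \<and>
     (\<exists>u v. (\<forall>n. (u n, v n) \<in> A) \<and>
        (\<lambda>n. ell2_norm (\<lambda>k. u n k - f k)) \<longlonglongrightarrow> 0 \<and>
        (\<lambda>n. ell2_norm (\<lambda>k. v n k - g k)) \<longlonglongrightarrow> 0)}"

definition generated_op :: "(nat \<Rightarrow> nat \<Rightarrow> complex) \<Rightarrow> ell2_op" where
  "generated_op T = op_closure {(f, \<lambda>i. \<Sum>j. T i j * f j) | f. f \<in> finitely_supported}"

text \<open>\<open>z\<close> belongs to the resolvent set iff \<open>A - z\<close> maps the domain of \<open>A\<close> bijectively onto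
  \<^const>\<open>ell2\<close> and the inverse is bounded.\<close>

definition resolvent_set :: "ell2_op \<Rightarrow> complex set" where
  "resolvent_set A = {z.
     (\<forall>h\<in>ell2. \<exists>!f. (f, \<lambda>k. h k + z * f k) \<in> A) \<and>
     (\<exists>C. \<forall>(f, g)\<in>A. ell2_norm f \<le> C * ell2_norm (\<lambda>k. g k - z * f k))}"

definition op_spectrum :: "ell2_op \<Rightarrow> complex set" where
  "op_spectrum A = - resolvent_set A"

definition densely_defined :: "ell2_op \<Rightarrow> bool" where
  "densely_defined A \<longleftrightarrow> (\<forall>g\<in>ell2. \<forall>e>0. \<exists>f\<in>Domain A. ell2_norm (\<lambda>k. f k - g k) < e)"

definition op_adjoint :: "ell2_op \<Rightarrow> ell2_op" where
  "op_adjoint A = {(f, g). f \<in> ell2 \<and> g \<in> ell2 \<and>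
     (\<forall>(u, v)\<in>A. ell2_inner v f = ell2_inner u g)}"

definition op_selfadjoint :: "ell2_op \<Rightarrow> bool" where
  "op_selfadjoint A \<longleftrightarrow> densely_defined A \<and> op_adjoint A = A"

text \<open>\<open>h(A) f = \<Sum>\<^sub>k h\<^sub>k A\<^sup>k f\<close> on the domain of \<open>A\<close> to the power \<open>degree h\<close>; here
  \<open>u k\<close> is \<open>A\<^sup>k f\<close>.\<close>

definition op_poly :: "real poly \<Rightarrow> ell2_op \<Rightarrow> ell2_op" where
  "op_poly h A = {(f, g). \<exists>u. u 0 = f \<and> (\<forall>k<degree h. (u k, u (Suc k)) \<in> A) \<and>
     g = (\<lambda>n. \<Sum>k\<le>degree h. of_real (coeff h k) * u k n)}"


section \<open>Krein spaces\<close>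

text \<open>The Krein space with fundamental symmetry \<open>G = mdiag \<epsilon>\<close>, where \<open>\<epsilon>\<close> has values in \<open>{1, -1}\<close>.\<close>

definition krein_inner :: "(nat \<Rightarrow> real) \<Rightarrow> (nat \<Rightarrow> complex) \<Rightarrow> (nat \<Rightarrow> complex) \<Rightarrow> complex" where
  "krein_inner \<epsilon> f g = ell2_inner (\<lambda>n. of_real (\<epsilon> n) * f n) g"

definition krein_selfadjoint :: "(nat \<Rightarrow> real) \<Rightarrow> ell2_op \<Rightarrow> bool" where
  "krein_selfadjoint \<epsilon> A \<longleftrightarrow> op_selfadjoint {(f, \<lambda>n. of_real (\<epsilon> n) * g n) | f g. (f, g) \<in> A}"

text \<open>Since \<open>A\<close> is generated by a tridiagonal matrix, it maps finitely supported sequences to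
  finitely supported ones, so all of them lie in the domain of \<open>h(A)\<close>.\<close>

definition definitizable :: "(nat \<Rightarrow> real) \<Rightarrow> ell2_op \<Rightarrow> bool" where
  "definitizable \<epsilon> A \<longleftrightarrow>
     (\<exists>T. tridiagonal T \<and> A = generated_op T) \<and>
     krein_selfadjoint \<epsilon> A \<and>
     resolvent_set A \<noteq> {} \<and>
     (\<exists>h. h \<noteq> 0 \<and> (\<forall>f\<in>finitely_supported. \<forall>g. (f, g) \<in> op_poly h A \<longrightarrow>
        krein_inner \<epsilon> g f \<in> \<real>\<^sub>\<ge>\<^sub>0))"


section \<open>Existence and uniqueness of the factorization\<close>

lemma mmult_factor:
  assumes "lower_bidiagonal L"
  shows "mmult (mmult L (mdiag e)) (mtranspose L) i j =
    L i i * e i * L j i + (case i of 0 \<Rightarrow> 0 | Suc m \<Rightarrow> L i m * e m * L j m)"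
proof -
  have 1: "mmult L (mdiag e) i k = L i k * e k" for k
    unfolding mmult_def mdiag_def
    by (subst suminf_finite[of "{k}"]) auto
  have z: "L i k = 0" if "k \<noteq> i" "i \<noteq> Suc k" for k
    using assms that unfolding lower_bidiagonal_def by metis
  show ?thesis
  proof (cases i)
    case 0
    have "mmult (mmult L (mdiag e)) (mtranspose L) i j = (\<Sum>k\<in>{i}. L i k * e k * L j k)"
      unfolding mmult_def[of "mmult L (mdiag e)"] 1 mtranspose_def
      by (rule suminf_finite) (use z 0 in auto)
    then show ?thesis using 0 by simp
  next
    case (Suc m)
    have "mmult (mmult L (mdiag e)) (mtranspose L) i j = (\<Sum>k\<in>{i,m}. L i k * e k * L j k)"
      unfolding mmult_def[of "mmult L (mdiag e)"] 1 mtranspose_def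
      by (rule suminf_finite) (use z Suc in auto)
    then show ?thesis using Suc by simp
  qed
qed

lemma signed_square_unique:
  fixes a b x y :: real
  assumes "a > 0" "b > 0" "x \<in> {1,-1}" "y \<in> {1,-1}" "x * (a * a) = y * (b * b)"
  shows "a = b \<and> x = y"
proof -
  have p: "a * a > 0" "b * b > 0" using assms by auto
  have "x = y"
  proof (rule ccontr)
    assume "x \<noteq> y"
    then have "a * a = - (b * b)" using assms(3-5) by auto
    with p show False by linarith
  qed
  moreover have "a * a = b * b" using assms \<open>x = y\<close> by auto
  then have "a = b" using assms(1,2) by (simp add: square_eq_iff)
  ultimately show ?thesis by simp
qed

lemma cos_multiple_nonzero:
  assumes "\<alpha> \<notin> \<rat>"
  shows "cos (real k * (pi * \<alpha>)) \<noteq> 0"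
proof
  assume a: "cos (real k * (pi * \<alpha>)) = 0"
  then have k: "k \<noteq> 0" by (intro notI) simp
  from a obtain i :: int where "real k * (pi * \<alpha>) = of_int i * (pi / 2)"
    unfolding cos_zero_iff_int by blast
  then have "pi * (real k * \<alpha>) = pi * (of_int i / 2)" by (simp add: algebra_simps)
  then have "real k * \<alpha> = of_int i / 2" by (metis mult_cancel_left pi_neq_zero)
  then have "\<alpha> = of_int i / 2 / real k" using k by (simp add: field_simps)
  also have "\<dots> \<in> \<rat>" by simp
  finally show False using assms by simp
qed

lemma signed_factorization_unique:
  assumes A: "signed_factorization J c L e" and B: "signed_factorization J c L' e'"
  shows "L = L' \<and> e = e'"
proof -
  have bd: "lower_bidiagonal L" "lower_bidiagonal L'" 
    and pos: "L j j > 0" "L' j j > 0" and sg: "e j \<in> {1,-1}" "e' j \<in> {1,-1}" for j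
    using A B unfolding signed_factorization_def by auto
  have eq: "L i i * e i * L j i + (case i of 0 \<Rightarrow> 0 | Suc m \<Rightarrow> L i m * e m * L j m)
    = L' i i * e' i * L' j i + (case i of 0 \<Rightarrow> 0 | Suc m \<Rightarrow> L' i m * e' m * L' j m)" for i j
  proof -
    have "mmult (mmult L (mdiag e)) (mtranspose L) i j = J i j - mdiag (\<lambda>_. c) i j"
      "mmult (mmult L' (mdiag e')) (mtranspose L') i j = J i j - mdiag (\<lambda>_. c) i j"
      using A B unfolding signed_factorization_def by auto
    then show ?thesis unfolding mmult_factor[OF bd(1)] mmult_factor[OF bd(2)] by simp
  qed
  have z: "L i k = 0" "L' i k = 0" if "k \<noteq> i" "i \<noteq> Suc k" for i k
    using bd that unfolding lower_bidiagonal_def by metis+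
  have *: "L n n = L' n n \<and> e n = e' n \<and> L (Suc n) n = L' (Suc n) n" for n
  proof (induction n)
    case 0
    have 1: "L 0 0 = L' 0 0 \<and> e 0 = e' 0"
    proof (rule signed_square_unique[OF pos sg])
      show "e 0 * (L 0 0 * L 0 0) = e' 0 * (L' 0 0 * L' 0 0)"
        using eq[of 0 0] by (simp add: mult_ac)
    qed
    have "e' 0 \<noteq> 0" using sg(2)[of 0] by auto
    then show ?case using 1 pos(2)[of 0] eq[of 0 1] by auto
  next
    case (Suc n)
    have 1: "L (Suc n) (Suc n) = L' (Suc n) (Suc n) \<and> e (Suc n) = e' (Suc n)"
    proof (rule signed_square_unique[OF pos sg])
      show "e (Suc n) * (L (Suc n) (Suc n) * L (Suc n) (Suc n)) =
          e' (Suc n) * (L' (Suc n) (Suc n) * L' (Suc n) (Suc n))"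
        using eq[of "Suc n" "Suc n"] Suc by (simp add: mult_ac)
    qed
    have "e' (Suc n) \<noteq> 0" using sg(2)[of "Suc n"] by auto
    then show ?case
      using 1 pos(2)[of "Suc n"] eq[of "Suc n" "Suc (Suc n)"] z[of n "Suc (Suc n)"] by auto
  qed
  have "L i j = L' i j" for i j
    using *[of i] *[of j] z[of j i] by (cases "i = j"; cases "i = Suc j") simp_all
  with * show ?thesis by (auto intro!: ext)
qed

theorem signed_factorization_J0_ex1:
  assumes irr: "\<alpha> \<notin> \<rat>"
  shows "\<exists>!(L, \<epsilon>). signed_factorization J0 (cos (pi * \<alpha>)) L \<epsilon>"
proof -
  define t where "t = pi * \<alpha>"
  define C where "C k = cos (real k * t)" for k
  have C: "C k \<noteq> 0" for k unfolding C_def t_def by (rule cos_multiple_nonzero[OF irr])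
  have rec: "C (Suc (Suc k)) = 2 * cos t * C (Suc k) - C k" for k
    unfolding C_def using cos_times_cos[of "real (Suc k) * t" t]
    by (simp add: algebra_simps)
  define d where "d j = (case j of 0 \<Rightarrow> - cos t | Suc m \<Rightarrow> - C (Suc j) / (2 * C j))" for j
  have dnz: "d j \<noteq> 0" for j
    using C[of 1] C[of j] C[of "Suc j"] unfolding d_def by (auto simp: C_def split: nat.splits)
  define b :: "nat \<Rightarrow> real" where "b j = (if j = 0 then 1 / sqrt 2 else 1/2)" for j
  have drec: "d (Suc j) = - cos t - (b j)\<^sup>2 / d j" for j
  proof (cases j)
    case 0
    have "C 1 = cos t" "C 0 = 1" unfolding C_def by auto
    then show ?thesis using rec[of 0] C[of 1] 0
      by (simp add: d_def b_def field_simps power2_eq_square)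
  next
    case (Suc m)
    have "C (Suc (Suc m)) \<noteq> 0" "C (Suc m) \<noteq> 0" using C by auto
    then show ?thesis using rec[of "Suc m"] Suc
      by (simp add: d_def b_def field_simps power2_eq_square)
  qed
  define L where "L i j = (if i = j then sqrt \<bar>d j\<bar> else if i = Suc j
     then b j * sgn (d j) / sqrt \<bar>d j\<bar> else 0)" for i j
  have bd: "lower_bidiagonal L" unfolding lower_bidiagonal_def L_def by auto
  have sg: "sgn (d j) * sgn (d j) = 1" "sgn (d j) * \<bar>d j\<bar> = d j" 
     "sqrt \<bar>d j\<bar> * sqrt \<bar>d j\<bar> = \<bar>d j\<bar>" "sqrt \<bar>d j\<bar> \<noteq> 0" for j
    using dnz[of j] by (auto simp: sgn_if)
  have e1: "L i i * sgn (d i) * L i i = d i" for i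
  proof -
    have "L i i * sgn (d i) * L i i = sgn (d i) * (sqrt \<bar>d i\<bar> * sqrt \<bar>d i\<bar>)"
      unfolding L_def by simp
    then show ?thesis unfolding sg .
  qed
  have e2: "L i i * sgn (d i) * L (Suc i) i = b i" for i
  proof -
    have "L i i * sgn (d i) * L (Suc i) i =
      b i * (sgn (d i) * sgn (d i)) * (sqrt \<bar>d i\<bar> / sqrt \<bar>d i\<bar>)"
      unfolding L_def by simp
    then show ?thesis using sg[of i] by simp
  qed
  have e3: "L (Suc i) i * sgn (d i) * L (Suc i) i = (b i)\<^sup>2 / d i" for i
  proof -
    have "L (Suc i) i * sgn (d i) * L (Suc i) i =
      (b i)\<^sup>2 * sgn (d i) * (sgn (d i) * sgn (d i)) / (sqrt \<bar>d i\<bar> * sqrt \<bar>d i\<bar>)"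
      unfolding L_def by (simp add: power2_eq_square)
    also have "\<dots> = (b i)\<^sup>2 / d i" unfolding sg using dnz[of i] by (auto simp: sgn_if)
    finally show ?thesis .
  qed
  have d0: "d 0 = - cos t" by (simp add: d_def)
  have mm: "J0 i j - mdiag (\<lambda>_. cos t) i j =
    mmult (mmult L (mdiag (\<lambda>j. sgn (d j)))) (mtranspose L) i j" for i j
  proof -
    have z: "L p q = 0" if "p \<noteq> q" "p \<noteq> Suc q" for p q using that by (simp add: L_def)
    consider "j = i" | "j = Suc i" | "i = Suc j" | "j \<noteq> i" "j \<noteq> Suc i" "i \<noteq> Suc j" by blast
    then show ?thesis
    proof cases
      case 1
      then show ?thesis unfolding mmult_factor[OF bd] using 1 e1[of i] e3[of "i - 1"] drec[of "i - 1"]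
        by (cases i) (simp_all add: J0_def mdiag_def d0)
    next
      case 2
      then show ?thesis unfolding mmult_factor[OF bd] using e2[of i] z
        by (cases i) (auto simp: J0_def mdiag_def b_def)
    next
      case 3
      have "L (Suc j) j * sgn (d j) * L j j = b j" using e2[of j] by (simp add: mult_ac)
      then show ?thesis unfolding mmult_factor[OF bd] using 3 z
        by (auto simp: J0_def mdiag_def b_def)
    next
      case 4
      then show ?thesis unfolding mmult_factor[OF bd] using z
        by (cases i) (auto simp: J0_def mdiag_def)
    qed
  qed
  have F: "signed_factorization J0 (cos (pi * \<alpha>)) L (\<lambda>j. sgn (d j))"
    unfolding signed_factorization_def
  proof (intro conjI allI)
    show "L j j > 0" for j using dnz[of j] by (simp add: L_def)
    show "sgn (d j) \<in> {1,-1}" for j using dnz[of j] by (auto simp: sgn_if)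
  qed (use bd mm in \<open>auto simp: t_def\<close>)
  show ?thesis
  proof (rule ex1I[of _ "(L, \<lambda>j. sgn (d j))"])
    show "case (L, \<lambda>j. sgn (d j)) of (L, \<epsilon>) \<Rightarrow> signed_factorization J0 (cos (pi * \<alpha>)) L \<epsilon>"
      using F by simp
    show "p = (L, \<lambda>j. sgn (d j))"
      if "case p of (L, \<epsilon>) \<Rightarrow> signed_factorization J0 (cos (pi * \<alpha>)) L \<epsilon>" for p
      using that signed_factorization_unique[OF _ F] by (cases p) simp
  qed
qed

end

theory Submission
  imports Defs "HOL-Analysis.Kronecker_Approximation_Theorem"
begin

text \<open>Write \<open>t = \<pi>\<alpha>\<close> and \<open>c = cos t\<close>. The pivots of the factorization are
  \<open>\<plusminus> cos ((j+1)t) / (2 cos (jt))\<close>, so the off-diagonal entries of the Darboux transformation are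
  unbounded but stay bounded along the \<open>j\<close> for which \<open>cos ((j+1)t)\<close> is bounded away from 0. Cutting off
  at such \<open>j\<close> shows that the generated operator is the maximal one and that \<open>G\<close> times it is
  self-adjoint. For the spectrum, use \<open>(G L\<^sup>T L + c - z) G L\<^sup>T = G L\<^sup>T (J\<^sub>0 - z)\<close>: since the multiples of
  \<open>\<alpha>\<close> are dense modulo 1, some columns of \<open>L\<^sup>T\<close> are arbitrarily large, and a vector \<open>g\<close> with
  \<open>g p = 1\<close> at such a column \<open>p\<close> but \<open>((J\<^sub>0 - z) g) p = 0\<close> gives \<open>v = G L\<^sup>T g\<close> of arbitrarily large
  norm with bounded image, for every complex \<open>z\<close>.\<close>

section \<open>Square summable sequences\<close>

lemma cmod_add_square_le: "(cmod (a + b))\<^sup>2 \<le> 2 * (cmod a)\<^sup>2 + 2 * (cmod b)\<^sup>2"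
proof -
  have "(cmod (a + b))\<^sup>2 \<le> (cmod a + cmod b)\<^sup>2"
    by (intro power_mono norm_triangle_ineq) auto
  also have "\<dots> \<le> 2 * (cmod a)\<^sup>2 + 2 * (cmod b)\<^sup>2"
    using sum_squares_bound[of "cmod a" "cmod b"] by (simp add: power2_sum)
  finally show ?thesis .
qed

lemma ell2_add:
  assumes "f \<in> ell2" "g \<in> ell2"
  shows "(\<lambda>n. f n + g n) \<in> ell2"
proof -
  have "summable (\<lambda>n. 2 * (cmod (f n))\<^sup>2 + 2 * (cmod (g n))\<^sup>2)"
    using assms by (intro summable_add summable_mult) (auto simp: ell2_def)
  then show ?thesis unfolding ell2_def mem_Collect_eq
    by (rule summable_comparison_test') (use cmod_add_square_le in auto)
qed

lemma ell2_cmult: "f \<in> ell2 \<Longrightarrow> (\<lambda>n. c * f n) \<in> ell2"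
  unfolding ell2_def by (simp add: norm_mult power_mult_distrib summable_mult)

lemma ell2_diff: "f \<in> ell2 \<Longrightarrow> g \<in> ell2 \<Longrightarrow> (\<lambda>n. f n - g n) \<in> ell2"
  using ell2_add[of f "\<lambda>n. -1 * g n"] ell2_cmult[of g "-1"] by simp

lemma finitely_supported_ell2: "f \<in> finitely_supported \<Longrightarrow> f \<in> ell2"
  unfolding finitely_supported_def ell2_def
  by (auto intro: summable_finite[of "{n. f n \<noteq> 0}"])

lemma cmod_le_ell2_norm:
  assumes "f \<in> ell2"
  shows "cmod (f i) \<le> ell2_norm f"
proof -
  have "(\<Sum>n\<in>{i}. (cmod (f n))\<^sup>2) \<le> (\<Sum>n. (cmod (f n))\<^sup>2)"
    using assms by (intro sum_le_suminf) (auto simp: ell2_def)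
  then show ?thesis unfolding ell2_norm_def by (simp add: real_le_rsqrt)
qed

lemma ell2_norm_nonneg: "f \<in> ell2 \<Longrightarrow> ell2_norm f \<ge> 0"
  using cmod_le_ell2_norm[of f 0] norm_ge_zero order_trans by blast

lemma ell2_tendsto_0: "f \<in> ell2 \<Longrightarrow> f \<longlonglongrightarrow> 0"
  unfolding ell2_def using summable_LIMSEQ_zero
  by (fastforce simp: tendsto_norm_zero_iff[of f, symmetric])

text \<open>The tail is padded with zeros to a series over all indices, so that it can be added to
  and compared with other series term by term.\<close>

lemma tail_sums:
  fixes h :: "nat \<Rightarrow> 'a :: real_normed_vector"
  assumes "summable h"
  shows "(\<lambda>i. if i \<le> n then 0 else h i) sums (suminf h - (\<Sum>i\<le>n. h i))"
proof -
  have "(\<lambda>i. h i - (if i \<in> {..n} then h i else 0)) sums (suminf h - (\<Sum>i\<in>{..n}. h i))"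
    by (intro sums_diff summable_sums assms sums_If_finite_set) auto
  moreover have "(\<lambda>i. h i - (if i \<in> {..n} then h i else 0)) = (\<lambda>i. if i \<le> n then 0 else h i)"
    by auto
  ultimately show ?thesis by simp
qed

lemma tail_tendsto_0:
  fixes h :: "nat \<Rightarrow> 'a :: real_normed_vector"
  assumes "summable h"
  shows "(\<lambda>n. suminf h - (\<Sum>i\<le>n. h i)) \<longlonglongrightarrow> 0"
  using tendsto_diff[OF tendsto_const[of "suminf h"] summable_LIMSEQ'[OF assms]] by simp

lemma ell2_norm_truncation:
  assumes "f \<in> ell2"
  shows "(\<lambda>n. ell2_norm (\<lambda>k. (if k \<le> n then f k else 0) - f k)) \<longlonglongrightarrow> 0"
proof -
  have s: "summable (\<lambda>n. (cmod (f n))\<^sup>2)" using assms by (simp add: ell2_def)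
  have "(\<lambda>k. (cmod ((if k \<le> n then f k else 0) - f k))\<^sup>2)
      = (\<lambda>k. if k \<le> n then 0 else (cmod (f k))\<^sup>2)" for n
    by auto
  then have "ell2_norm (\<lambda>k. (if k \<le> n then f k else 0) - f k)
      = sqrt ((\<Sum>n. (cmod (f n))\<^sup>2) - (\<Sum>i\<le>n. (cmod (f i))\<^sup>2))" for n
    unfolding ell2_norm_def using sums_unique[OF tail_sums[OF s, of n]] by simp
  then show ?thesis using tendsto_real_sqrt[OF tail_tendsto_0[OF s]] by simp
qed

lemma ell2_inner_summable:
  assumes "f \<in> ell2" "g \<in> ell2"
  shows "summable (\<lambda>n. f n * cnj (g n))"
proof (rule summable_comparison_test')
  show "summable (\<lambda>n. (cmod (f n))\<^sup>2 + (cmod (g n))\<^sup>2)"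
    using assms by (intro summable_add) (auto simp: ell2_def)
  show "norm (f n * cnj (g n)) \<le> (cmod (f n))\<^sup>2 + (cmod (g n))\<^sup>2" for n
  proof -
    have "cmod (f n) * cmod (g n) \<ge> 0" by simp
    then show ?thesis using sum_squares_bound[of "cmod (f n)" "cmod (g n)"]
      unfolding norm_mult complex_mod_cnj by linarith
  qed
qed


section \<open>Operators generated by tridiagonal matrices\<close>

text \<open>The maximal operator of \<open>T\<close>: matrix multiplication on every
  \<open>f\<close> in \<open>ell2\<close> whose image is again in \<open>ell2\<close>. Membership is
  an entrywise condition, with no limit involved.\<close>

definition maximal_op :: "(nat \<Rightarrow> nat \<Rightarrow> complex) \<Rightarrow> ell2_op" where
  "maximal_op T = {(f, g). f \<in> ell2 \<and> g \<in> ell2 \<and> (\<forall>i. g i = (\<Sum>j. T i j * f j))}"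

text \<open>At most three entries of a row are nonzero, so the series is a finite sum; the case
  distinction drops the missing left neighbour in row 0.\<close>

lemma tridiagonal_row:
  assumes "tridiagonal T"
  shows "(\<Sum>j. T i j * f j) = (case i of 0 \<Rightarrow> 0 | Suc k \<Rightarrow> T i k * f k) + T i i * f i
    + T i (Suc i) * f (Suc i)"
proof -
  have z: "T i j = 0" if "j \<noteq> i" "j \<noteq> Suc i" "i \<noteq> Suc j" for j
    using assms that unfolding tridiagonal_def by metis
  show ?thesis
  proof (cases i)
    case 0
    have "(\<Sum>j. T i j * f j) = (\<Sum>j\<in>{i, Suc i}. T i j * f j)"
      by (rule suminf_finite) (use z 0 in auto)
    then show ?thesis using 0 by simp
  next
    case (Suc k)
    have "(\<Sum>j. T i j * f j) = (\<Sum>j\<in>{k, i, Suc i}. T i j * f j)"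
      by (rule suminf_finite) (use z Suc in auto)
    then show ?thesis using Suc by simp
  qed
qed

lemma tridiagonal_finitely_supported:
  assumes "tridiagonal T" "f \<in> finitely_supported"
  shows "(\<lambda>i. \<Sum>j. T i j * f j) \<in> finitely_supported"
proof -
  have "finite {n. f n \<noteq> 0}" using assms(2) by (simp add: finitely_supported_def)
  then obtain N where N: "n < N" if "f n \<noteq> 0" for n
    unfolding finite_nat_set_iff_bounded by auto
  have "(\<Sum>j. T i j * f j) = 0" if "i \<ge> Suc N" for i
  proof -
    have "f i = 0" "f (Suc i) = 0" "f (i - 1) = 0"
      using N[of i] N[of "Suc i"] N[of "i - 1"] that by fastforce+
    then show ?thesis unfolding tridiagonal_row[OF assms(1)] by (auto split: nat.splits)
  qed
  then have "{i. (\<Sum>j. T i j * f j) \<noteq> 0} \<subseteq> {..<Suc N}" by (auto simp: not_le[symmetric])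
  then show ?thesis unfolding finitely_supported_def using finite_subset by blast
qed

lemma finitely_supported_maximal_op:
  assumes "tridiagonal T" "f \<in> finitely_supported"
  shows "(f, \<lambda>i. \<Sum>j. T i j * f j) \<in> maximal_op T"
  using assms tridiagonal_finitely_supported finitely_supported_ell2
  by (simp add: maximal_op_def)

text \<open>Norm convergence implies convergence of each coordinate, and a coordinate of
  \<open>T u\<close> is a finite combination of coordinates of \<open>u\<close>, so the relation
  \<open>g = T f\<close> survives the closure.\<close>

lemma generated_op_subset_maximal_op:
  assumes T: "tridiagonal T"
  shows "generated_op T \<subseteq> maximal_op T"
proof (clarify, goal_cases)
  case (1 f g)
  then obtain u v where fg: "f \<in> ell2" "g \<in> ell2"
    and uv: "\<And>n. (u n, v n) \<in> {(f, \<lambda>i. \<Sum>j. T i j * f j) | f. f \<in> finitely_supported}"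
    and u: "(\<lambda>n. ell2_norm (\<lambda>k. u n k - f k)) \<longlonglongrightarrow> 0"
    and v: "(\<lambda>n. ell2_norm (\<lambda>k. v n k - g k)) \<longlonglongrightarrow> 0"
    unfolding generated_op_def op_closure_def by blast
  have un: "u n \<in> finitely_supported" and vn: "v n = (\<lambda>i. \<Sum>j. T i j * u n j)" for n
    using uv[of n] by auto
  have pw: "(\<lambda>n. w n i) \<longlonglongrightarrow> h i"
    if "(\<lambda>n. ell2_norm (\<lambda>k. w n k - h k)) \<longlonglongrightarrow> 0" "h \<in> ell2" "\<And>n. w n \<in> ell2" for w h i
  proof (rule Lim_null[THEN iffD2], rule Lim_null_comparison[OF _ that(1)], rule always_eventually)
    show "\<forall>n. norm (w n i - h i) \<le> ell2_norm (\<lambda>k. w n k - h k)"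
      using cmod_le_ell2_norm[OF ell2_diff[OF that(3,2)]] by blast
  qed
  have up: "(\<lambda>n. u n i) \<longlonglongrightarrow> f i" for i
    using pw[OF u fg(1)] un finitely_supported_ell2 by blast
  have "v n \<in> ell2" for n
    unfolding vn using tridiagonal_finitely_supported[OF T un] finitely_supported_ell2 by blast
  then have vp: "(\<lambda>n. v n i) \<longlonglongrightarrow> g i" for i using pw[OF v fg(2)] by blast
  have "(\<lambda>n. v n i) \<longlonglongrightarrow> (\<Sum>j. T i j * f j)" for i
    unfolding vn tridiagonal_row[OF T] by (cases i) (auto intro!: tendsto_intros up)
  with vp have "g i = (\<Sum>j. T i j * f j)" for i using LIMSEQ_unique by blast
  with fg show ?case by (simp add: maximal_op_def)
qed

text \<open>Cutting \<open>f\<close> off after position \<open>n\<close> changes \<open>T f\<close> only by a tail and by the two boundary terms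
  at \<open>n\<close> and \<open>n + 1\<close>, which vanish in the limit along the \<open>n\<close> with bounded off-diagonal entries.\<close>

lemma maximal_op_subset_generated_op:
  assumes T: "tridiagonal T" and r: "strict_mono (r :: nat \<Rightarrow> nat)"
    and K: "\<And>k. cmod (T (r k) (Suc (r k))) \<le> K" "\<And>k. cmod (T (Suc (r k)) (r k)) \<le> K"
  shows "maximal_op T \<subseteq> generated_op T"
proof (clarify, goal_cases)
  case (1 f g)
  then have fg: "f \<in> ell2" "g \<in> ell2" and g: "g i = (\<Sum>j. T i j * f j)" for i
    by (auto simp: maximal_op_def)
  define u where "u k = (\<lambda>i. if i \<le> r k then f i else 0)" for k
  define v where "v k = (\<lambda>i. \<Sum>j. T i j * u k j)" for k
  have fs: "u k \<in> finitely_supported" for k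
    unfolding u_def finitely_supported_def
    by (auto intro: finite_subset[of _ "{..r k}"])
  have u: "(\<lambda>n. ell2_norm (\<lambda>k. u n k - f k)) \<longlonglongrightarrow> 0"
    unfolding u_def using LIMSEQ_subseq_LIMSEQ[OF ell2_norm_truncation[OF fg(1)] r]
    by (simp add: o_def)
  \<comment> \<open>\<open>B n\<close> dominates the boundary terms in rows \<open>n\<close> and
    \<open>n + 1\<close>; its factor 2 absorbs the one from \<open>cmod_add_square_le\<close>.
    \<open>G n\<close> is the tail of the squared norm of \<open>g\<close>.\<close>
  define B where "B n = 2 * (K\<^sup>2 * ((cmod (f n))\<^sup>2 + (cmod (f (Suc n)))\<^sup>2))" for n
  define G where "G n = (\<Sum>i. (cmod (g i))\<^sup>2) - (\<Sum>i\<le>n. (cmod (g i))\<^sup>2)" for n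
  have sg: "summable (\<lambda>n. (cmod (g n))\<^sup>2)" using fg(2) by (simp add: ell2_def)
  have bound: "ell2_norm (\<lambda>i. v k i - g i) \<le> sqrt (2 * G (r k) + 2 * B (r k))" for k
  proof -
    let ?n = "r k"
    have ge: "g ?n = (case ?n of 0 \<Rightarrow> 0 | Suc k \<Rightarrow> T ?n k * f k) + T ?n ?n * f ?n
        + T ?n (Suc ?n) * f (Suc ?n)"
      using g[of ?n] tridiagonal_row[OF T] by simp
    have ve: "v k ?n = (case ?n of 0 \<Rightarrow> 0 | Suc k \<Rightarrow> T ?n k * f k) + T ?n ?n * f ?n"
      unfolding v_def tridiagonal_row[OF T] u_def by (simp split: nat.splits)
    \<comment> \<open>Row \<open>r k\<close> loses its right neighbour, the next row keeps nothing
      but its left neighbour, earlier rows are unchanged and later ones vanish.\<close>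
    have e1: "v k ?n - g ?n = - (T ?n (Suc ?n) * f (Suc ?n))"
      unfolding ge ve by simp
    have e2: "v k (Suc ?n) - g (Suc ?n) = T (Suc ?n) ?n * f ?n + - g (Suc ?n)"
      unfolding v_def tridiagonal_row[OF T] u_def by simp
    have e3: "v k i - g i = 0" if "i < ?n" for i
      unfolding v_def g tridiagonal_row[OF T] u_def using that by (simp split: nat.splits)
    have e4: "v k i - g i = - g i" if "i > Suc ?n" for i
      unfolding v_def tridiagonal_row[OF T] u_def using that by (simp split: nat.splits)
    have b1: "(cmod (T ?n (Suc ?n) * f (Suc ?n)))\<^sup>2 \<le> B ?n / 2"
    proof -
      have "(cmod (T ?n (Suc ?n) * f (Suc ?n)))\<^sup>2 \<le> K\<^sup>2 * (cmod (f (Suc ?n)))\<^sup>2"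
        unfolding norm_mult power_mult_distrib using K(1)[of k]
        by (intro mult_right_mono power_mono) auto
      also have "\<dots> \<le> B ?n / 2" unfolding B_def by (simp add: algebra_simps)
      finally show ?thesis .
    qed
    have b2: "(cmod (T (Suc ?n) ?n * f ?n))\<^sup>2 \<le> B ?n / 2"
    proof -
      have "(cmod (T (Suc ?n) ?n * f ?n))\<^sup>2 \<le> K\<^sup>2 * (cmod (f ?n))\<^sup>2"
        unfolding norm_mult power_mult_distrib using K(2)[of k]
        by (intro mult_right_mono power_mono) auto
      also have "\<dots> \<le> B ?n / 2" unfolding B_def by (simp add: algebra_simps)
      finally show ?thesis .
    qed
    have B0: "B ?n \<ge> 0" unfolding B_def by simp
    have le: "(cmod (v k i - g i))\<^sup>2 \<le>
        2 * (if i \<le> ?n then 0 else (cmod (g i))\<^sup>2) + (if i \<in> {?n, Suc ?n} then B ?n else 0)" for i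
    proof -
      consider "i < ?n" | "i = ?n" | "i = Suc ?n" | "i > Suc ?n" by linarith
      then show ?thesis
      proof cases
        case 1
        then show ?thesis using e3 B0 by simp
      next
        case 2
        then show ?thesis using e1 b1 B0 by simp
      next
        case 3
        have "(cmod (v k i - g i))\<^sup>2 \<le> 2 * (cmod (T (Suc ?n) ?n * f ?n))\<^sup>2 + 2 * (cmod (g i))\<^sup>2"
          using cmod_add_square_le[of "T (Suc ?n) ?n * f ?n" "- g (Suc ?n)"] 3 e2 by simp
        with b2 3 show ?thesis by simp
      next
        case 4
        then show ?thesis using e4 by simp
      qed
    qed
    have "(\<lambda>i. 2 * (if i \<le> ?n then 0 else (cmod (g i))\<^sup>2) +
        (if i \<in> {?n, Suc ?n} then B ?n else 0)) sums (2 * G ?n + (\<Sum>i\<in>{?n, Suc ?n}. B ?n))"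
      unfolding G_def by (intro sums_add sums_mult tail_sums sg sums_If_finite_set) auto
    then have s: "(\<lambda>i. 2 * (if i \<le> ?n then 0 else (cmod (g i))\<^sup>2) +
        (if i \<in> {?n, Suc ?n} then B ?n else 0)) sums (2 * G ?n + 2 * B ?n)" by simp
    have "v k \<in> ell2"
      unfolding v_def using tridiagonal_finitely_supported[OF T fs] finitely_supported_ell2 by blast
    then have "summable (\<lambda>i. (cmod (v k i - g i))\<^sup>2)"
      using ell2_diff[OF _ fg(2)] by (auto simp: ell2_def)
    then have "(\<Sum>i. (cmod (v k i - g i))\<^sup>2) \<le> 2 * G ?n + 2 * B ?n"
      using suminf_le[OF le _ sums_summable[OF s]] sums_unique[OF s] by simp
    then show ?thesis unfolding ell2_norm_def by simp
  qed
  have f0: "(\<lambda>k. f (r k)) \<longlonglongrightarrow> 0" "(\<lambda>k. f (Suc (r k))) \<longlonglongrightarrow> 0"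
    using LIMSEQ_subseq_LIMSEQ[OF ell2_tendsto_0[OF fg(1)] r]
      LIMSEQ_subseq_LIMSEQ[OF LIMSEQ_Suc[OF ell2_tendsto_0[OF fg(1)]] r] by (auto simp: o_def)
  have "(\<lambda>k. G (r k)) \<longlonglongrightarrow> 0"
    unfolding G_def using LIMSEQ_subseq_LIMSEQ[OF tail_tendsto_0[OF sg] r] by (simp add: o_def)
  moreover have "(\<lambda>k. B (r k)) \<longlonglongrightarrow> 2 * (K\<^sup>2 * ((cmod 0)\<^sup>2 + (cmod 0)\<^sup>2))"
    unfolding B_def by (intro tendsto_intros f0)
  ultimately have "(\<lambda>k. sqrt (2 * G (r k) + 2 * B (r k))) \<longlonglongrightarrow>
      sqrt (2 * 0 + 2 * (2 * (K\<^sup>2 * ((cmod 0)\<^sup>2 + (cmod 0)\<^sup>2))))"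
    by (intro tendsto_intros)
  then have lim: "(\<lambda>k. sqrt (2 * G (r k) + 2 * B (r k))) \<longlonglongrightarrow> 0" by simp
  have "norm (ell2_norm (\<lambda>i. v k i - g i)) \<le> sqrt (2 * G (r k) + 2 * B (r k))" for k
  proof -
    have "ell2_norm (\<lambda>i. v k i - g i) \<ge> 0"
      unfolding v_def
      by (intro ell2_norm_nonneg ell2_diff finitely_supported_ell2 tridiagonal_finitely_supported T fs fg)
    with bound[of k] show ?thesis by simp
  qed
  then have v: "(\<lambda>n. ell2_norm (\<lambda>k. v n k - g k)) \<longlonglongrightarrow> 0"
    by (intro Lim_null_comparison[OF _ lim] always_eventually) blast
  have "(u k, v k) \<in> {(f, \<lambda>i. \<Sum>j. T i j * f j) | f. f \<in> finitely_supported}" for k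
    using fs v_def by blast
  with u v fg show ?case unfolding generated_op_def op_closure_def by blast
qed

lemma generated_op_eq_maximal_op:
  assumes "tridiagonal T" "strict_mono (r :: nat \<Rightarrow> nat)"
    and "\<And>k. cmod (T (r k) (Suc (r k))) \<le> K" "\<And>k. cmod (T (Suc (r k)) (r k)) \<le> K"
  shows "generated_op T = maximal_op T"
  using generated_op_subset_maximal_op[OF assms(1)] maximal_op_subset_generated_op[OF assms] by blast

section \<open>Self-adjointness of maximal operators\<close>

text \<open>Testing the adjoint relation on unit vectors shows that the adjoint acts by the matrix.
  Conversely, symmetry follows from the discrete Green formula, whose boundary term vanishes along
  \<open>r\<close>.\<close>

lemma maximal_op_selfadjoint:
  assumes T: "tridiagonal T" and r: "strict_mono (r :: nat \<Rightarrow> nat)"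
    and K: "\<And>k. cmod (T (r k) (Suc (r k))) \<le> K"
    and herm: "\<And>i j. T j i = cnj (T i j)"
  shows "op_selfadjoint (maximal_op T)"
proof -
  have K': "cmod (T (Suc (r k)) (r k)) \<le> K" for k
    using K[of k] herm[where i = "r k" and j = "Suc (r k)"] by simp
  have dense: "densely_defined (maximal_op T)"
    unfolding densely_defined_def
  proof (intro ballI allI impI)
    fix g :: "nat \<Rightarrow> complex" and e :: real
    assume g: "g \<in> ell2" and e: "e > 0"
    have "eventually (\<lambda>n. ell2_norm (\<lambda>k. (if k \<le> n then g k else 0) - g k) < e) sequentially"
      using order_tendstoD(2)[OF ell2_norm_truncation[OF g] e] .
    then obtain n where n: "ell2_norm (\<lambda>k. (if k \<le> n then g k else 0) - g k) < e"
      by (auto dest: eventually_happens)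
    have "(\<lambda>k. if k \<le> n then g k else 0) \<in> finitely_supported"
      unfolding finitely_supported_def by (auto intro: finite_subset[of _ "{..n}"])
    with n finitely_supported_maximal_op[OF T] show "\<exists>f\<in>Domain (maximal_op T). ell2_norm (\<lambda>k. f k - g k) < e"
      by (intro bexI[of _ "\<lambda>k. if k \<le> n then g k else 0"] DomainI)
  qed
  have sub: "op_adjoint (maximal_op T) \<subseteq> maximal_op T"
  proof (clarify, goal_cases)
    case (1 f g)
    then have fg: "f \<in> ell2" "g \<in> ell2"
      and adj: "\<And>u v. (u, v) \<in> maximal_op T \<Longrightarrow> ell2_inner v f = ell2_inner u g"
      unfolding op_adjoint_def by auto
    have "g k = (\<Sum>j. T k j * f j)" for k
    proof -
      define u :: "nat \<Rightarrow> complex" where "u i = (if i = k then 1 else 0)" for i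
      have fs: "u \<in> finitely_supported"
        unfolding finitely_supported_def u_def by (auto intro: finite_subset[of _ "{k}"])
      have row: "(\<Sum>j. T i j * u j) = T i k" for i
        by (subst suminf_finite[of "{k}"]) (auto simp: u_def)
      have "ell2_inner (\<lambda>i. T i k) f = ell2_inner u g"
        using adj[OF finitely_supported_maximal_op[OF T fs]] unfolding row .
      moreover have "ell2_inner u g = cnj (g k)"
        unfolding ell2_inner_def by (subst suminf_finite[of "{k}"]) (auto simp: u_def)
      moreover have "ell2_inner (\<lambda>i. T i k) f = (\<Sum>j\<le>Suc k. T j k * cnj (f j))"
        unfolding ell2_inner_def
        by (rule suminf_finite) (use T in \<open>auto simp: tridiagonal_def not_le\<close>)
      moreover have "(\<Sum>j. T k j * f j) = (\<Sum>j\<le>Suc k. T k j * f j)"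
        by (rule suminf_finite) (use T in \<open>auto simp: tridiagonal_def not_le\<close>)
      moreover have "(\<Sum>j\<le>Suc k. T j k * cnj (f j)) = cnj (\<Sum>j\<le>Suc k. T k j * f j)"
        unfolding cnj_sum complex_cnj_mult using herm[of _ k] by simp
      ultimately show ?thesis by (metis complex_cnj_cancel_iff)
    qed
    with fg show ?case by (simp add: maximal_op_def)
  qed
  have sup: "maximal_op T \<subseteq> op_adjoint (maximal_op T)"
  proof (clarify, goal_cases)
    case (1 f g)
    then have fg: "f \<in> ell2" "g \<in> ell2" and g: "g i = (\<Sum>j. T i j * f j)" for i
      by (auto simp: maximal_op_def)
    have "ell2_inner v f = ell2_inner u g" if "(u, v) \<in> maximal_op T" for u v
    proof -
      have uv: "u \<in> ell2" "v \<in> ell2" and v: "v i = (\<Sum>j. T i j * u j)" for i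
        using that by (auto simp: maximal_op_def)
      \<comment> \<open>The partial sums telescope by hermiticity; what remains is the coupling
        between positions \<open>n\<close> and \<open>n + 1\<close>.\<close>
      have green: "(\<Sum>i\<le>n. v i * cnj (f i)) - (\<Sum>i\<le>n. u i * cnj (g i)) =
          T n (Suc n) * u (Suc n) * cnj (f n) - cnj (T n (Suc n)) * u n * cnj (f (Suc n))" for n
      proof (induction n)
        case 0
        have h: "cnj (T 0 0) = T 0 0" by (rule herm[symmetric])
        show ?case unfolding v g tridiagonal_row[OF T] by (simp add: h algebra_simps)
      next
        case (Suc n)
        have s: "(\<Sum>i\<le>Suc n. v i * cnj (f i)) - (\<Sum>i\<le>Suc n. u i * cnj (g i)) =
          (\<Sum>i\<le>n. v i * cnj (f i)) - (\<Sum>i\<le>n. u i * cnj (g i))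
           + (v (Suc n) * cnj (f (Suc n)) - u (Suc n) * cnj (g (Suc n)))" by simp
        have h: "cnj (T (Suc n) (Suc n)) = T (Suc n) (Suc n)" "T (Suc n) n = cnj (T n (Suc n))"
          by (rule herm[symmetric], rule herm)
        show ?case unfolding s Suc.IH unfolding v g tridiagonal_row[OF T]
          by (simp add: h algebra_simps)
      qed
      have bounded_mult: "(\<lambda>k. a k * b k * c k) \<longlonglongrightarrow> 0"
        if "\<And>k. cmod (a k) \<le> K" "b \<longlonglongrightarrow> 0" "c \<longlonglongrightarrow> 0" for a b c :: "nat \<Rightarrow> complex"
      proof (rule Lim_null_comparison)
        have "K \<ge> 0" using that(1)[of 0] norm_ge_zero order_trans by blast
        then show "\<forall>\<^sub>F k in sequentially. norm (a k * b k * c k) \<le> K * cmod (b k) * cmod (c k)"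
          using that(1) by (intro always_eventually allI) (auto simp: norm_mult intro!: mult_right_mono)
        have "(\<lambda>k. K * cmod (b k) * cmod (c k)) \<longlonglongrightarrow> K * cmod 0 * cmod 0"
          by (intro tendsto_intros that)
        then show "(\<lambda>k. K * cmod (b k) * cmod (c k)) \<longlonglongrightarrow> 0" by simp
      qed
      have lim0: "(\<lambda>k. h (r k)) \<longlonglongrightarrow> 0" "(\<lambda>k. h (Suc (r k))) \<longlonglongrightarrow> 0"
        "(\<lambda>k. cnj (h (r k))) \<longlonglongrightarrow> 0" "(\<lambda>k. cnj (h (Suc (r k)))) \<longlonglongrightarrow> 0" if "h \<in> ell2" for h
      proof -
        show *: "(\<lambda>k. h (r k)) \<longlonglongrightarrow> 0" "(\<lambda>k. h (Suc (r k))) \<longlonglongrightarrow> 0"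
          using LIMSEQ_subseq_LIMSEQ[OF ell2_tendsto_0[OF that] r]
            LIMSEQ_subseq_LIMSEQ[OF LIMSEQ_Suc[OF ell2_tendsto_0[OF that]] r] by (auto simp: o_def)
        show "(\<lambda>k. cnj (h (r k))) \<longlonglongrightarrow> 0" "(\<lambda>k. cnj (h (Suc (r k)))) \<longlonglongrightarrow> 0"
          using *[THEN tendsto_cnj] by auto
      qed
      \<comment> \<open>Along \<open>r\<close> the coupling entries stay below \<open>K\<close>
        while the coordinates of \<open>u\<close> and \<open>f\<close> tend to 0. The same sequence
        converges to the difference of the inner products, which is therefore 0.\<close>
      have "(\<lambda>k. (\<Sum>i\<le>r k. v i * cnj (f i)) - (\<Sum>i\<le>r k. u i * cnj (g i))) \<longlonglongrightarrow> 0 - 0"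
        unfolding green by (intro tendsto_diff bounded_mult lim0 uv fg) (use K in auto)
      moreover have "(\<lambda>k. (\<Sum>i\<le>r k. v i * cnj (f i)) - (\<Sum>i\<le>r k. u i * cnj (g i)))
          \<longlonglongrightarrow> ell2_inner v f - ell2_inner u g"
        unfolding ell2_inner_def
        using LIMSEQ_subseq_LIMSEQ[OF tendsto_diff[OF
            summable_LIMSEQ'[OF ell2_inner_summable[OF uv(2) fg(1)]]
            summable_LIMSEQ'[OF ell2_inner_summable[OF uv(1) fg(2)]]] r]
        by (simp add: o_def)
      ultimately have "ell2_inner v f - ell2_inner u g = 0 - 0"
        using LIMSEQ_unique by blast
      then show ?thesis by simp
    qed
    with fg show ?case unfolding op_adjoint_def by auto
  qed
  from dense sub sup show ?thesis unfolding op_selfadjoint_def by blast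
qed

text \<open>Multiplication by the signs is an isometric involution of \<open>ell2\<close>, so
  \<open>G\<close> times the maximal operator of \<open>T\<close> is the maximal operator of the
  hermitian matrix \<open>G T\<close>.\<close>

lemma krein_selfadjoint_maximal_op:
  assumes T: "tridiagonal T" and r: "strict_mono (r :: nat \<Rightarrow> nat)"
    and K: "\<And>k. cmod (T (r k) (Suc (r k))) \<le> K"
    and sgn: "\<And>j. \<epsilon> j \<in> {1, -1}"
    and herm: "\<And>i j. of_real (\<epsilon> j) * T j i = cnj (of_real (\<epsilon> i) * T i j)"
  shows "krein_selfadjoint \<epsilon> (maximal_op T)"
proof -
  define H where "H i j = of_real (\<epsilon> i) * T i j" for i j
  have e2: "of_real (\<epsilon> i) * (of_real (\<epsilon> i) * x) = (x :: complex)" for i x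
    using sgn[of i] by auto
  have n1: "cmod (of_real (\<epsilon> i) * x) = cmod x" for i x
    using sgn[of i] by auto
  have ell: "(\<lambda>n. of_real (\<epsilon> n) * g n) \<in> ell2 \<longleftrightarrow> g \<in> ell2" for g
    unfolding ell2_def by (simp only: n1 mem_Collect_eq)
  have row: "(\<Sum>j. H i j * f j) = of_real (\<epsilon> i) * (\<Sum>j. T i j * f j)" for i f
  proof -
    have "tridiagonal H" using T unfolding tridiagonal_def H_def by auto
    then show ?thesis unfolding tridiagonal_row[OF T] tridiagonal_row[OF \<open>tridiagonal H\<close>]
      by (auto simp: H_def algebra_simps split: nat.splits)
  qed
  have "{(f, \<lambda>n. of_real (\<epsilon> n) * g n) | f g. (f, g) \<in> maximal_op T} = maximal_op H"
  proof (intro subset_antisym subsetI)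
    fix p assume "p \<in> {(f, \<lambda>n. of_real (\<epsilon> n) * g n) | f g. (f, g) \<in> maximal_op T}"
    then show "p \<in> maximal_op H" unfolding maximal_op_def by (auto simp: row ell)
  next
    fix p assume p: "p \<in> maximal_op H"
    obtain f h where fh: "p = (f, h)" by (cases p)
    have h: "h \<in> ell2" using p unfolding fh maximal_op_def by simp
    have "(f, \<lambda>n. of_real (\<epsilon> n) * h n) \<in> maximal_op T"
    proof -
      have f: "f \<in> ell2" and hi: "h i = of_real (\<epsilon> i) * (\<Sum>j. T i j * f j)" for i
        using p unfolding fh maximal_op_def row by auto
      have "of_real (\<epsilon> i) * h i = (\<Sum>j. T i j * f j)" for i by (simp only: hi e2)
      moreover have "(\<lambda>n. of_real (\<epsilon> n) * h n) \<in> ell2" using h by (simp only: ell)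
      ultimately show ?thesis unfolding maximal_op_def using f by blast
    qed
    then have "(f, \<lambda>n. of_real (\<epsilon> n) * (of_real (\<epsilon> n) * h n)) \<in>
        {(f, \<lambda>n. of_real (\<epsilon> n) * g n) | f g. (f, g) \<in> maximal_op T}"
      by (intro CollectI exI[of _ f] exI[of _ "\<lambda>n. of_real (\<epsilon> n) * h n"]) simp
    then show "p \<in> {(f, \<lambda>n. of_real (\<epsilon> n) * g n) | f g. (f, g) \<in> maximal_op T}"
      unfolding fh by (simp only: e2)
  qed
  moreover have "op_selfadjoint (maximal_op H)"
  proof (rule maximal_op_selfadjoint[OF _ r])
    show "tridiagonal H" using T unfolding tridiagonal_def H_def by auto
    show "cmod (H (r k) (Suc (r k))) \<le> K" for k unfolding H_def n1 by (rule K)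
    show "H j i = cnj (H i j)" for i j unfolding H_def by (rule herm)
  qed
  ultimately show ?thesis unfolding krein_selfadjoint_def by simp
qed


section \<open>Cosines of multiples of an irrational angle\<close>

text \<open>Density of the multiples of \<open>\<alpha>\<close> modulo 1 brings some of them close
  to 1/2, where the cosine of \<open>\<pi>\<close> times the number vanishes.\<close>

lemma cos_multiple_small:
  assumes irr: "\<alpha> \<notin> \<rat>" and \<delta>: "\<delta> > 0"
  shows "\<exists>p\<ge>N. \<bar>cos (real p * (pi * \<alpha>))\<bar> < \<delta>"
proof -
  \<comment> \<open>The density theorem gives a positive index without a prescribed lower bound. As
    \<open>D\<close> is at most every \<open>\<bar>cos\<bar>\<close> with index below
    \<open>N\<close>, a value under \<open>D\<close> forces the index to be at least
    \<open>N\<close>.\<close>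
  define D where "D = Min (insert \<delta> ((\<lambda>k. \<bar>cos (real k * (pi * \<alpha>))\<bar>) ` {..<N}))"
  have D0: "D > 0" unfolding D_def using \<delta> cos_multiple_nonzero[OF irr] by auto
  have D\<delta>: "D \<le> \<delta>" unfolding D_def by (intro Min_le) auto
  have DN: "D \<le> \<bar>cos (real k * (pi * \<alpha>))\<bar>" if "k < N" for k
    unfolding D_def using that by (intro Min_le) auto
  obtain h k :: int where k: "k > 0" and hk: "\<bar>of_int k * \<alpha> - of_int h - 1/2\<bar> < D / pi"
    using sequence_of_fractional_parts_is_dense[OF irr divide_pos_pos[OF D0 pi_gt_zero], where \<alpha> = "1/2"]
    by blast
  define e where "e = of_int k * \<alpha> - of_int h - 1/2"
  have "real (nat k) * (pi * \<alpha>) = pi * of_int h + (pi / 2 + pi * e)"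
    using k by (simp add: e_def algebra_simps)
  then have "\<bar>cos (real (nat k) * (pi * \<alpha>))\<bar> = \<bar>sin (pi * e)\<bar>"
    by (simp add: cos_add sin_add abs_mult)
  also have "\<dots> \<le> \<bar>pi * e\<bar>" by (rule abs_sin_x_le_abs_x)
  also have "\<dots> < D" using hk by (simp add: e_def abs_mult pos_less_divide_eq mult.commute)
  finally have *: "\<bar>cos (real (nat k) * (pi * \<alpha>))\<bar> < D" .
  then have "nat k \<ge> N" using DN[of "nat k"] by linarith
  with * D\<delta> show ?thesis by force
qed

text \<open>A small \<open>cos x\<close> makes \<open>\<bar>sin x\<bar>\<close> at least 3/4, so in
  the addition formula the sine product, at least \<open>3 / 4 * s\<close>, outweighs the cosine
  product, at most \<open>s / 4\<close>.\<close>

lemma cos_add_lower_bound: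
  fixes x y s :: real
  assumes x: "\<bar>cos x\<bar> \<le> s / 4" and s: "0 < s" "s \<le> \<bar>sin y\<bar>"
  shows "\<bar>cos (x + y)\<bar> \<ge> s / 2"
proof -
  have s1: "s \<le> 1" using s(2) abs_sin_le_one[of y] by linarith
  have "\<bar>cos x\<bar> * \<bar>cos y\<bar> \<le> s / 4 * 1" by (intro mult_mono x) (use s in auto)
  then have a: "\<bar>cos x * cos y\<bar> \<le> s / 4" by (simp add: abs_mult)
  have "\<bar>cos x\<bar>\<^sup>2 \<le> (1 / 4)\<^sup>2" by (intro power_mono) (use x s1 in auto)
  then have "(3 / 4)\<^sup>2 \<le> \<bar>sin x\<bar>\<^sup>2" using sin_cos_squared_add[of x] by (simp add: power2_eq_square)
  then have "3 / 4 \<le> \<bar>sin x\<bar>" by (rule power2_le_imp_le) simp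
  then have "3 / 4 * s \<le> \<bar>sin x\<bar> * \<bar>sin y\<bar>" by (intro mult_mono) (use s in auto)
  then have b: "3 / 4 * s \<le> \<bar>sin x * sin y\<bar>" by (simp add: abs_mult)
  show ?thesis unfolding cos_add using a b by linarith
qed


section \<open>Entries of the factorization\<close>

text \<open>Comparison of the diagonals and first superdiagonals of both sides of the
  factorization.\<close>

lemma signed_factorization_J0_entries:
  assumes F: "signed_factorization J0 c L \<epsilon>"
  shows "\<epsilon> 0 * (L 0 0)\<^sup>2 = - c"
    and "\<epsilon> (Suc j) * (L (Suc j) (Suc j))\<^sup>2 + \<epsilon> j * (L (Suc j) j)\<^sup>2 = - c"
    and "\<epsilon> j * L j j * L (Suc j) j = J0 j (Suc j)"
proof -
  have bd: "lower_bidiagonal L"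
    and eq: "J0 i j - mdiag (\<lambda>_. c) i j = mmult (mmult L (mdiag \<epsilon>)) (mtranspose L) i j" for i j
    using F unfolding signed_factorization_def by auto
  show "\<epsilon> 0 * (L 0 0)\<^sup>2 = - c"
    using eq[of 0 0] unfolding mmult_factor[OF bd]
    by (simp add: J0_def mdiag_def power2_eq_square mult_ac)
  show "\<epsilon> (Suc j) * (L (Suc j) (Suc j))\<^sup>2 + \<epsilon> j * (L (Suc j) j)\<^sup>2 = - c"
    using eq[of "Suc j" "Suc j"] unfolding mmult_factor[OF bd]
    by (simp add: J0_def mdiag_def power2_eq_square mult_ac)
  have "L (Suc j) i = 0" if "j = Suc i" for i
    using bd that unfolding lower_bidiagonal_def by auto
  then show "\<epsilon> j * L j j * L (Suc j) j = J0 j (Suc j)"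
    using eq[of j "Suc j"] unfolding mmult_factor[OF bd]
    by (auto simp: mdiag_def mult_ac split: nat.splits)
qed

text \<open>The pivots obey \<open>d (j+1) = - c - b\<^sub>j\<^sup>2 / d j\<close>, where
  \<open>b\<^sub>j\<close> is the off-diagonal entry of \<open>J0\<close>. The three-term recurrence
  of \<open>cos (k t)\<close> solves this; the exceptional entry \<open>1 / sqrt 2\<close> accounts
  for the factor 1 at \<open>j = 0\<close>.\<close>

lemma signed_factorization_J0_cos:
  assumes F: "signed_factorization J0 (cos t) L \<epsilon>"
    and nz: "\<And>k :: nat. cos (real k * t) \<noteq> 0"
  shows "\<epsilon> j * (L j j)\<^sup>2 =
    - cos (real (Suc j) * t) / ((if j = 0 then 1 else 2) * cos (real j * t))"
proof (induction j)
  case 0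
  show ?case using signed_factorization_J0_entries(1)[OF F] by simp
next
  case (Suc j)
  define C where "C k = cos (real k * t)" for k
  define d where "d k = \<epsilon> k * (L k k)\<^sup>2" for k
  have C: "C k \<noteq> 0" for k using nz by (simp add: C_def)
  have rec: "C (Suc (Suc k)) = 2 * cos t * C (Suc k) - C k" for k
    unfolding C_def using cos_times_cos[of "real (Suc k) * t" t]
    by (simp add: algebra_simps)
  have dj: "d j = - C (Suc j) / ((if j = 0 then 1 else 2) * C j)"
    using Suc unfolding d_def C_def .
  have "\<epsilon> j \<in> {1, -1}" using F unfolding signed_factorization_def by auto
  then have "\<epsilon> j * \<epsilon> j = 1" by auto
  \<comment> \<open>Squaring the superdiagonal relation expresses the subdiagonal entry of
    \<open>L\<close> through the pivot.\<close>
  then have "d j * (\<epsilon> j * (L (Suc j) j)\<^sup>2) = (\<epsilon> j * L j j * L (Suc j) j)\<^sup>2"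
    unfolding d_def by (simp add: power2_eq_square mult_ac)
  also have "\<dots> = (if j = 0 then 1 / 2 else 1 / 4)"
    unfolding signed_factorization_J0_entries(3)[OF F] by (simp add: J0_def power2_eq_square)
  finally have "d j * (\<epsilon> j * (L (Suc j) j)\<^sup>2) = (if j = 0 then 1 / 2 else 1 / 4)" .
  moreover have "d j \<noteq> 0" using dj C by simp
  ultimately have "\<epsilon> j * (L (Suc j) j)\<^sup>2 = (if j = 0 then 1 / 2 else 1 / 4) / d j"
    by (simp add: eq_divide_eq mult.commute)
  then have "d (Suc j) = - cos t - (if j = 0 then 1 / 2 else 1 / 4) / d j"
    using signed_factorization_J0_entries(2)[OF F, of j] unfolding d_def by linarith
  also have "\<dots> = - C (Suc (Suc j)) / (2 * C (Suc j))"
    unfolding dj rec using C[of j] C[of "Suc j"]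
    by (cases "j = 0") (simp_all add: field_simps C_def)
  finally show ?case unfolding d_def C_def by simp
qed

text \<open>Absolute values of the pivots give the first square; the second follows because the
  product of the two entries has modulus 1/2 from row 1 on. A small cosine at \<open>Suc j\<close>
  thus makes the subdiagonal entry large.\<close>

lemma signed_factorization_J0_squares:
  assumes F: "signed_factorization J0 (cos t) L \<epsilon>"
    and nz: "\<And>k :: nat. cos (real k * t) \<noteq> 0" and j: "j \<ge> 1"
  shows "(L j j)\<^sup>2 = \<bar>cos (real (Suc j) * t)\<bar> / (2 * \<bar>cos (real j * t)\<bar>)"
    and "(L (Suc j) j)\<^sup>2 = \<bar>cos (real j * t)\<bar> / (2 * \<bar>cos (real (Suc j) * t)\<bar>)"
proof -
  have e: "\<epsilon> j \<in> {1, -1}" using F unfolding signed_factorization_def by auto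
  then have "(L j j)\<^sup>2 = \<bar>\<epsilon> j * (L j j)\<^sup>2\<bar>" by (auto simp: abs_mult)
  also have "\<dots> = \<bar>cos (real (Suc j) * t)\<bar> / (2 * \<bar>cos (real j * t)\<bar>)"
    unfolding signed_factorization_J0_cos[OF F nz] using j by (simp add: abs_mult del: of_nat_Suc)
  finally show 1: "(L j j)\<^sup>2 = \<bar>cos (real (Suc j) * t)\<bar> / (2 * \<bar>cos (real j * t)\<bar>)" .
  have "(\<epsilon> j * L j j * L (Suc j) j)\<^sup>2 = (L j j)\<^sup>2 * (L (Suc j) j)\<^sup>2"
    using e by (auto simp: power_mult_distrib)
  then have "(L j j)\<^sup>2 * (L (Suc j) j)\<^sup>2 = 1 / 4"
    unfolding signed_factorization_J0_entries(3)[OF F] using j by (simp add: J0_def power2_eq_square)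
  then show "(L (Suc j) j)\<^sup>2 = \<bar>cos (real j * t)\<bar> / (2 * \<bar>cos (real (Suc j) * t)\<bar>)"
    unfolding 1 using nz[of j] nz[of "Suc j"] by (simp add: field_simps del: of_nat_Suc)
qed


section \<open>The shifted Darboux transformation\<close>

lemma shifted_darboux_entry:
  assumes "lower_bidiagonal L"
  shows "shifted_darboux c L \<epsilon> i j =
    \<epsilon> i * (L i i * L i j + L (Suc i) i * L (Suc i) j) + (if i = j then c else 0)"
proof -
  have 1: "mmult (mdiag \<epsilon>) (mtranspose L) i k = \<epsilon> i * L k i" for k
    unfolding mmult_def mdiag_def mtranspose_def
    by (subst suminf_finite[of "{i}"]) auto
  have "L k i = 0" if "k \<noteq> i" "k \<noteq> Suc i" for k
    using assms that unfolding lower_bidiagonal_def by metis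
  then have "mmult (mmult (mdiag \<epsilon>) (mtranspose L)) L i j = (\<Sum>k\<in>{i, Suc i}. \<epsilon> i * L k i * L k j)"
    unfolding mmult_def[of "mmult (mdiag \<epsilon>) (mtranspose L)"] 1
    by (intro suminf_finite) auto
  then show ?thesis unfolding shifted_darboux_def by (simp add: mdiag_def algebra_simps)
qed

lemma lower_bidiagonal_zero: "lower_bidiagonal L \<Longrightarrow> i \<noteq> j \<Longrightarrow> i \<noteq> Suc j \<Longrightarrow> L i j = 0"
  by (simp add: lower_bidiagonal_def)

lemma tridiagonal_shifted_darboux:
  assumes "lower_bidiagonal L"
  shows "tridiagonal (\<lambda>i j. complex_of_real (shifted_darboux c L \<epsilon> i j))"
  unfolding tridiagonal_def shifted_darboux_entry[OF assms]
  by (simp add: lower_bidiagonal_zero[OF assms])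

lemma shifted_darboux_off_diagonal:
  assumes "lower_bidiagonal L"
  shows "shifted_darboux c L \<epsilon> i (Suc i) = \<epsilon> i * (L (Suc i) i * L (Suc i) (Suc i))"
    and "shifted_darboux c L \<epsilon> (Suc i) i = \<epsilon> (Suc i) * (L (Suc i) i * L (Suc i) (Suc i))"
  unfolding shifted_darboux_entry[OF assms] by (simp_all add: lower_bidiagonal_zero[OF assms])

lemma tridiagonal_J0: "tridiagonal (\<lambda>i j. complex_of_real (J0 i j))"
  by (simp add: tridiagonal_def J0_def)

text \<open>The intertwining relation \<open>(G L\<^sup>T L + c - z) G L\<^sup>T = G L\<^sup>T (J\<^sub>0 - z)\<close>.\<close>

lemma shifted_darboux_intertwining:
  fixes g :: "nat \<Rightarrow> complex" and z :: complex
  assumes F: "signed_factorization J0 c L \<epsilon>"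
  defines "v \<equiv> \<lambda>i. of_real (\<epsilon> i) * (of_real (L i i) * g i + of_real (L (Suc i) i) * g (Suc i))"
    and "q \<equiv> \<lambda>i. (\<Sum>j. of_real (J0 i j) * g j) - z * g i"
  shows "(\<Sum>j. of_real (shifted_darboux c L \<epsilon> i j) * v j) - z * v i =
    of_real (\<epsilon> i) * (of_real (L i i) * q i + of_real (L (Suc i) i) * q (Suc i))"
proof -
  have bd: "lower_bidiagonal L" using F by (simp add: signed_factorization_def)
  define l m where "l i = complex_of_real (L i i)" and "m i = complex_of_real (L (Suc i) i)" for i
  define e where "e i = complex_of_real (\<epsilon> i)" for i
  \<comment> \<open>\<open>w\<close> is \<open>L v\<close>. Since \<open>v = G L\<^sup>T g\<close>,
    it equals \<open>(J\<^sub>0 - c) g\<close>, that is, \<open>q + (z - c) g\<close>.\<close>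
  define w where "w i = (case i of 0 \<Rightarrow> 0 | Suc k \<Rightarrow> m k * v k) + l i * v i" for i
  have c1: "e 0 * (l 0)\<^sup>2 = - of_real c"
    and c2: "e (Suc j) * (l (Suc j))\<^sup>2 + e j * (m j)\<^sup>2 = - of_real c"
    and c3: "e j * l j * m j = of_real (J0 j (Suc j))" for j
    unfolding e_def l_def m_def
    using signed_factorization_J0_entries[OF F, THEN arg_cong[of _ _ complex_of_real]]
    by simp_all
  have v: "v i = e i * (l i * g i + m i * g (Suc i))" for i
    unfolding v_def e_def l_def m_def ..
  have J0_diag: "J0 i i = 0" and J0_sym: "J0 (Suc i) i = J0 i (Suc i)" for i
    by (simp_all add: J0_def)
  have w: "w i = q i + (z - of_real c) * g i" for i
  proof (cases i)
    case 0
    have "w i = (e 0 * (l 0)\<^sup>2) * g 0 + (e 0 * l 0 * m 0) * g (Suc 0)"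
      unfolding w_def v 0 by (simp add: algebra_simps power2_eq_square)
    then show ?thesis unfolding c1 c3 q_def tridiagonal_row[OF tridiagonal_J0]
      by (simp add: 0 J0_diag algebra_simps)
  next
    case (Suc k)
    have "w i = (e k * l k * m k) * g k + (e (Suc k) * (l (Suc k))\<^sup>2 + e k * (m k)\<^sup>2) * g (Suc k)
        + (e (Suc k) * l (Suc k) * m (Suc k)) * g (Suc (Suc k))"
      unfolding w_def v Suc by (simp add: algebra_simps power2_eq_square)
    then show ?thesis unfolding c2 c3 q_def tridiagonal_row[OF tridiagonal_J0]
      by (simp add: Suc J0_diag J0_sym algebra_simps)
  qed
  have "(\<Sum>j. of_real (shifted_darboux c L \<epsilon> i j) * v j) =
      e i * (l i * w i + m i * w (Suc i)) + of_real c * v i"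
    unfolding tridiagonal_row[OF tridiagonal_shifted_darboux[OF bd]]
    unfolding shifted_darboux_entry[OF bd] w_def
    by (cases i) (simp_all add: lower_bidiagonal_zero[OF bd] e_def l_def m_def algebra_simps)
  \<comment> \<open>Applying \<open>G L\<^sup>T\<close> to \<open>(z - c) g\<close> gives
    \<open>(z - c) v\<close>, and adding \<open>c v\<close> leaves \<open>z v\<close>.\<close>
  also have "\<dots> = e i * (l i * q i + m i * q (Suc i)) + z * v i"
    unfolding w by (simp add: v algebra_simps)
  finally show ?thesis unfolding e_def l_def m_def by simp
qed


section \<open>Bounds from the size of the cosines\<close>

text \<open>For \<open>n \<ge> 1\<close> the squared product is
  \<open>C n * C (n+2) / (4 * (C (n+1))\<^sup>2)\<close> with
  \<open>C k = \<bar>cos (k t)\<bar>\<close>, so it is bounded over the \<open>n\<close> for which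
  \<open>C (n+1)\<close> stays away from 0.\<close>

lemma shifted_darboux_off_diagonal_bounded:
  assumes F: "signed_factorization J0 (cos t) L \<epsilon>"
    and nz: "\<And>k :: nat. cos (real k * t) \<noteq> 0" and t: "sin t \<noteq> 0"
  shows "\<exists>r K. strict_mono (r :: nat \<Rightarrow> nat) \<and>
    (\<forall>k. \<bar>L (Suc (r k)) (r k) * L (Suc (r k)) (Suc (r k))\<bar> \<le> K)"
proof -
  \<comment> \<open>With \<open>4 * s = \<bar>sin t\<bar>\<close> in
    \<open>cos_add_lower_bound\<close>, a cosine below \<open>s\<close> is followed by one of
    modulus at least \<open>2 * s\<close>.\<close>
  define s where "s = \<bar>sin t\<bar> / 4"
  have s: "s > 0" "s \<le> 1 / 4" using t abs_sin_le_one[of t] unfolding s_def by auto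
  define K where "K = 1 / (2 * s)"
  define S where "S = {n. n \<ge> 1 \<and> \<bar>cos (real (Suc n) * t)\<bar> \<ge> s}"
  \<comment> \<open>two consecutive cosines cannot both be small\<close>
  have "\<exists>n\<ge>N. n \<in> S" for N
  proof (rule ccontr)
    assume none: "\<not> (\<exists>n\<ge>N. n \<in> S)"
    have small: "\<bar>cos (real (Suc n) * t)\<bar> < s" if "n \<ge> Suc N" for n
    proof -
      have "n \<notin> S" using none that by auto
      then show ?thesis unfolding S_def using that by auto
    qed
    define x where "x = real (Suc (Suc N)) * t"
    have "\<bar>cos x\<bar> < s" "\<bar>cos (x + t)\<bar> < s"
      using small[of "Suc N"] small[of "Suc (Suc N)"] unfolding x_def by (auto simp: algebra_simps)
    moreover have "\<bar>cos (x + t)\<bar> \<ge> 4 * s / 2" if "\<bar>cos x\<bar> \<le> 4 * s / 4"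
      using that s by (intro cos_add_lower_bound) (auto simp: s_def)
    ultimately show False using s by auto
  qed
  then have "infinite S" unfolding infinite_nat_iff_unbounded_le by blast
  then obtain r :: "nat \<Rightarrow> nat" where r: "strict_mono r" "\<And>k. r k \<in> S"
    using infinite_enumerate by blast
  have "\<bar>L (Suc n) n * L (Suc n) (Suc n)\<bar> \<le> K" if "n \<in> S" for n
  proof -
    define C where "C k = \<bar>cos (real k * t)\<bar>" for k
    have C1: "C k \<le> 1" "C k \<ge> 0" for k unfolding C_def by auto
    have n: "n \<ge> 1" "s \<le> C (Suc n)" using that by (auto simp: S_def C_def)
    have "(L (Suc n) n * L (Suc n) (Suc n))\<^sup>2 = (C n / (2 * C (Suc n))) * (C (Suc (Suc n)) / (2 * C (Suc n)))"
      unfolding power_mult_distrib C_def using signed_factorization_J0_squares[OF F nz] n(1) by simp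
    also have "\<dots> \<le> (1 / (2 * s)) * (1 / (2 * s))"
      using C1 s n by (intro mult_mono frac_le) auto
    finally have "\<bar>L (Suc n) n * L (Suc n) (Suc n)\<bar>\<^sup>2 \<le> K\<^sup>2" unfolding K_def by (simp add: power2_eq_square)
    then show ?thesis by (rule power2_le_imp_le) (use s in \<open>simp add: K_def\<close>)
  qed
  with r show ?thesis by blast
qed

text \<open>In the proof, the large column of \<open>L\<^sup>T\<close> is \<open>p = m + 2\<close>, where \<open>cos (p t)\<close> is small, and \<open>g\<close> is
  supported on \<open>{p, p + 1}\<close> with \<open>g (p + 1) = 2 z\<close> forcing \<open>((J\<^sub>0 - z) g) p = 0\<close>.\<close>

lemma shifted_darboux_not_bounded_below:
  fixes z :: complex and M :: real
  assumes F: "signed_factorization J0 (cos t) L \<epsilon>" and t: "t = pi * \<alpha>" "\<alpha> \<notin> \<rat>"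
  shows "\<exists>v\<in>finitely_supported.
    ell2_norm v > M * ell2_norm (\<lambda>i. (\<Sum>j. of_real (shifted_darboux (cos t) L \<epsilon> i j) * v j) - z * v i)"
proof -
  define C where "C k = \<bar>cos (real k * t)\<bar>" for k
  have nz: "cos (real k * t) \<noteq> 0" for k
    unfolding t(1) by (rule cos_multiple_nonzero[OF t(2)])
  have C1: "C k \<le> 1" "C k > 0" for k unfolding C_def using nz by auto
  have e: "\<epsilon> j \<in> {1, -1}" for j using F unfolding signed_factorization_def by auto
  have bd: "lower_bidiagonal L" using F unfolding signed_factorization_def by auto
  have "cos t \<noteq> 0" using nz[of 1] by simp
  have "sin t \<noteq> 0"
  proof
    assume "sin t = 0"
    then obtain i :: int where "t = of_int i * pi" unfolding sin_zero_iff_int2 by blast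
    then have "\<alpha> = of_int i" using t(1) by simp
    then show False using t(2) by simp
  qed
  \<comment> \<open>\<open>sin t\<close> controls the cosines at distance 1 from the index
    \<open>p\<close> chosen below, and \<open>sin (2 * t)\<close> the one at
    \<open>p + 2\<close>.\<close>
  define s where "s = min \<bar>sin t\<bar> \<bar>sin (2 * t)\<bar>"
  have s: "s > 0" "s \<le> \<bar>sin t\<bar>" "s \<le> \<bar>sin (2 * t)\<bar>"
    using \<open>cos t \<noteq> 0\<close> \<open>sin t \<noteq> 0\<close> unfolding s_def sin_double by auto
  \<comment> \<open>\<open>Q\<close> is the sum of the moduli of the three possibly nonzero values
    of \<open>q\<close>. \<open>W\<close> is \<open>M\<^sup>2\<close> times a bound for the squared
    norm of \<open>w\<close>: five rows, each contributing at most
    \<open>4 * (1 / s * Q\<^sup>2)\<close>.\<close>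
  define Q where "Q = 1 / 2 + cmod (1 / 2 - 2 * z\<^sup>2) + cmod z"
  have Q: "Q \<ge> 0" unfolding Q_def by simp
  define W where "W = M\<^sup>2 * (5 * (4 * (1 / s * Q\<^sup>2)))"
  have W: "W \<ge> 0" unfolding W_def using s by simp
  \<comment> \<open>The first bound keeps the neighbouring cosines at least \<open>s / 2\<close>;
    the second makes the squared large entry at least \<open>W + 1\<close>.\<close>
  define \<delta> where "\<delta> = min (s / 4) (s / (4 * (W + 1)))"
  have "\<delta> > 0" unfolding \<delta>_def using s W by auto
  \<comment> \<open>\<open>p \<ge> 3\<close> gives \<open>m \<ge> 1\<close>, which keeps all rows
    involved clear of the exceptional entry of \<open>J0\<close>.\<close>
  then obtain p where p: "p \<ge> 3" "C p < \<delta>"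
    using cos_multiple_small[OF t(2), of \<delta> 3] unfolding C_def t(1) by blast
  define m where "m = p - 2"
  have m: "m \<ge> 1" "p = Suc (Suc m)" using p(1) by (auto simp: m_def)
  have near: "C k \<ge> s / 2" if "real k * t = real p * t + y" "s \<le> \<bar>sin y\<bar>" for k y
    unfolding C_def that(1) using p(2) s that(2) \<delta>_def unfolding C_def
    by (intro cos_add_lower_bound) auto
  have Cm: "C (Suc m) \<ge> s / 2" "C (Suc (Suc (Suc m))) \<ge> s / 2" "C (Suc (Suc (Suc (Suc m)))) \<ge> s / 2"
    using near[of "Suc m" "- t"] near[of "Suc (Suc (Suc m))" t] near[of "Suc (Suc (Suc (Suc m)))" "2 * t"] s m(2)
    by (auto simp: algebra_simps)
  define l u where "l i = L i i" and "u i = L (Suc i) i" for i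
  have l: "(l j)\<^sup>2 = C (Suc j) / (2 * C j)" and u: "(u j)\<^sup>2 = C j / (2 * C (Suc j))" if "j \<ge> 1" for j
    unfolding l_def u_def C_def using signed_factorization_J0_squares[OF F nz that] .
  have quot: "C i / (2 * C j) \<le> 1 / s" if "C j \<ge> s / 2" for i j
    using frac_le[of 1 "C i" s "2 * C j"] C1 s that by simp

  define g :: "nat \<Rightarrow> complex" where "g = (\<lambda>_. 0)(p := 1, Suc p := 2 * z)"
  define q where "q i = (\<Sum>j. of_real (J0 i j) * g j) - z * g i" for i
  define v where "v i = of_real (\<epsilon> i) * (of_real (l i) * g i + of_real (u i) * g (Suc i))" for i
  define w where "w i = (\<Sum>j. of_real (shifted_darboux (cos t) L \<epsilon> i j) * v j) - z * v i" for i
  have w: "w i = of_real (\<epsilon> i) * (of_real (l i) * q i + of_real (u i) * q (Suc i))" for i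
    unfolding w_def v_def q_def l_def u_def by (rule shifted_darboux_intertwining[OF F])
  have q: "q i = (if i = Suc m then 1 / 2 else if i = Suc (Suc (Suc m)) then 1 / 2 - 2 * z\<^sup>2
      else if i = Suc (Suc (Suc (Suc m))) then z else 0)" for i
    unfolding q_def tridiagonal_row[OF tridiagonal_J0] g_def m(2) using m(1)
    by (cases i) (auto simp: J0_def power2_eq_square)
  have qQ: "(cmod (q i))\<^sup>2 \<le> Q\<^sup>2" for i
    unfolding q Q_def by (intro power_mono) auto
  \<comment> \<open>The small \<open>C p\<close> is the denominator in \<open>l p\<close> and in
    \<open>u (p - 1)\<close>, and both of these are multiplied by \<open>q p = 0\<close>. The other
    entries that meet a nonzero \<open>q\<close> have denominators bounded below by
    \<open>Cm\<close>.\<close>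
  have lq: "(l i)\<^sup>2 * (cmod (q i))\<^sup>2 \<le> 1 / s * Q\<^sup>2" for i
  proof (cases "i \<in> {Suc m, Suc (Suc (Suc m)), Suc (Suc (Suc (Suc m)))}")
    case True
    then have "(l i)\<^sup>2 \<le> 1 / s" using l[of i] quot Cm by auto
    then show ?thesis using qQ[of i] s by (intro mult_mono) auto
  next
    case False
    then show ?thesis using s unfolding q by auto
  qed
  have uq: "(u i)\<^sup>2 * (cmod (q (Suc i)))\<^sup>2 \<le> 1 / s * Q\<^sup>2" for i
  proof (cases "i \<in> {m, Suc (Suc m), Suc (Suc (Suc m))}")
    case True
    then have "(u i)\<^sup>2 \<le> 1 / s" using u[of i] quot Cm m(1) by auto
    then show ?thesis using qQ[of "Suc i"] s by (intro mult_mono) auto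
  next
    case False
    then show ?thesis using s unfolding q by auto
  qed
  have wb: "(cmod (w i))\<^sup>2 \<le> 4 * (1 / s * Q\<^sup>2)" for i
  proof -
    have "cmod (w i) = cmod (of_real (l i) * q i + of_real (u i) * q (Suc i))"
      unfolding w using e[of i] by (auto simp: norm_mult)
    then have "(cmod (w i))\<^sup>2 \<le> 2 * ((l i)\<^sup>2 * (cmod (q i))\<^sup>2) + 2 * ((u i)\<^sup>2 * (cmod (q (Suc i)))\<^sup>2)"
      using cmod_add_square_le[of "of_real (l i) * q i" "of_real (u i) * q (Suc i)"]
      by (simp add: norm_mult power_mult_distrib)
    with lq[of i] uq[of i] show ?thesis by linarith
  qed
  have w0: "w i = 0" if "i \<notin> {m..m + 4}" for i
    unfolding w q using that by auto
  then have "{i. w i \<noteq> 0} \<subseteq> {m..m + 4}" by blast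
  then have wl: "w \<in> ell2"
    by (intro finitely_supported_ell2) (auto simp: finitely_supported_def intro: finite_subset)
  have "(\<Sum>i. (cmod (w i))\<^sup>2) = (\<Sum>i\<in>{m..m + 4}. (cmod (w i))\<^sup>2)"
    by (rule suminf_finite) (use w0 in auto)
  also have "\<dots> \<le> of_nat (card {m..m + 4}) * (4 * (1 / s * Q\<^sup>2))"
    by (rule sum_bounded_above) (rule wb)
  finally have "ell2_norm w \<le> sqrt (5 * (4 * (1 / s * Q\<^sup>2)))"
    unfolding ell2_norm_def by simp
  then have "M * ell2_norm w \<le> \<bar>M\<bar> * sqrt (5 * (4 * (1 / s * Q\<^sup>2)))"
    using ell2_norm_nonneg[OF wl] by (intro mult_mono) auto
  also have "\<dots> = sqrt W" unfolding W_def real_sqrt_mult[of "M\<^sup>2"] by simp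
  \<comment> \<open>At position \<open>p - 1\<close> the vector \<open>g\<close> vanishes while
    \<open>g p = 1\<close>, so \<open>v\<close> there has the modulus of the large entry
    \<open>u (p - 1)\<close>.\<close>
  also have "\<dots> < cmod (v (Suc m))"
  proof -
    have "W + 1 \<le> s / (4 * C p)"
    proof -
      have "C p \<le> s / (4 * (W + 1))" using p(2) unfolding \<delta>_def by simp
      then show ?thesis using W C1(2)[of p] by (simp add: field_simps)
    qed
    also have "\<dots> \<le> C (Suc m) / (2 * C p)"
      using Cm(1) C1(2)[of p] by (simp add: field_simps)
    also have "\<dots> = (u (Suc m))\<^sup>2" using u[of "Suc m"] m by simp
    also have "\<dots> = (cmod (v (Suc m)))\<^sup>2"
      unfolding v_def g_def using m e[of "Suc m"] by (auto simp: norm_mult)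
    finally have "W < (cmod (v (Suc m)))\<^sup>2" by simp
    then show ?thesis by (intro real_less_lsqrt) auto
  qed
  also have v: "v \<in> finitely_supported"
  proof -
    have "v i = 0" if "i \<notin> {..Suc p}" for i unfolding v_def g_def using that by auto
    then have "{i. v i \<noteq> 0} \<subseteq> {..Suc p}" by blast
    then show ?thesis unfolding finitely_supported_def using finite_subset by blast
  qed
  then have "cmod (v (Suc m)) \<le> ell2_norm v"
    by (intro cmod_le_ell2_norm finitely_supported_ell2)
  finally show ?thesis using v unfolding w_def by blast
qed

section \<open>Spectrum, self-adjointness and definitizability\<close>

theorem theorem4p4:
  fixes \<alpha> :: real and L :: "nat \<Rightarrow> nat \<Rightarrow> real" and \<epsilon> :: "nat \<Rightarrow> real"
  assumes "0 < \<alpha>" and "\<alpha> < 1" and "\<alpha> \<notin> \<rat>"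
    and "signed_factorization J0 (cos (pi * \<alpha>)) L \<epsilon>"
  shows "let A = generated_op (\<lambda>i j. complex_of_real (shifted_darboux (cos (pi * \<alpha>)) L \<epsilon> i j)) in
    op_spectrum A = UNIV \<and> krein_selfadjoint \<epsilon> A \<and> \<not> definitizable \<epsilon> A"
proof -
  define T where "T = (\<lambda>i j. complex_of_real (shifted_darboux (cos (pi * \<alpha>)) L \<epsilon> i j))"
  have F: "signed_factorization J0 (cos (pi * \<alpha>)) L \<epsilon>" by (rule assms(4))
  have bd: "lower_bidiagonal L" and e: "\<epsilon> j \<in> {1, -1}" for j
    using F unfolding signed_factorization_def by auto
  have e2: "\<epsilon> j * \<epsilon> j = 1" "\<bar>\<epsilon> j\<bar> = 1" for j using e[of j] by auto
  have T: "tridiagonal T" unfolding T_def by (rule tridiagonal_shifted_darboux[OF bd])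
  have "sin (pi * \<alpha>) > 0" using assms(1,2) by (intro sin_gt_zero) auto
  then obtain r :: "nat \<Rightarrow> nat" and K where r: "strict_mono r"
    and K: "\<And>k. \<bar>L (Suc (r k)) (r k) * L (Suc (r k)) (Suc (r k))\<bar> \<le> K"
    using shifted_darboux_off_diagonal_bounded[OF F cos_multiple_nonzero[OF assms(3)]] by fastforce
  have TK: "cmod (T (r k) (Suc (r k))) \<le> K" "cmod (T (Suc (r k)) (r k)) \<le> K" for k
    using K[of k] unfolding T_def shifted_darboux_off_diagonal[OF bd] norm_of_real
    by (simp_all add: abs_mult e2)
  have gen: "generated_op T = maximal_op T"
    by (rule generated_op_eq_maximal_op[OF T r TK])
  \<comment> \<open>\<open>G\<close> times the transformation is \<open>L\<^sup>T L + c G\<close>, a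
    real symmetric matrix.\<close>
  have "\<epsilon> j * shifted_darboux (cos (pi * \<alpha>)) L \<epsilon> j i = \<epsilon> i * shifted_darboux (cos (pi * \<alpha>)) L \<epsilon> i j" for i j
  proof -
    have z: "L a b = 0" if "a \<noteq> b" "a \<noteq> Suc b" for a b
      using lower_bidiagonal_zero[OF bd that] .
    consider "i = j" | "i = Suc j" | "j = Suc i" | "i \<noteq> j" "i \<noteq> Suc j" "j \<noteq> Suc i" by blast
    then show ?thesis
    proof cases
      case 4
      then show ?thesis unfolding shifted_darboux_entry[OF bd] by (simp add: z)
    qed (simp_all add: shifted_darboux_off_diagonal[OF bd] mult.assoc[symmetric] e2)
  qed
  from this[THEN arg_cong[of _ _ complex_of_real]]
  have herm: "of_real (\<epsilon> j) * T j i = cnj (of_real (\<epsilon> i) * T i j)" for i j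
    unfolding T_def by simp
  have sa: "krein_selfadjoint \<epsilon> (generated_op T)"
    unfolding gen by (rule krein_selfadjoint_maximal_op[OF T r TK(1) e herm])
  \<comment> \<open>The bounded-inverse condition fails at every \<open>z\<close>: finitely
    supported vectors lie in the domain, and some of them violate any proposed constant
    \<open>M\<close>.\<close>
  have "z \<notin> resolvent_set (generated_op T)" for z
  proof
    assume "z \<in> resolvent_set (generated_op T)"
    then obtain M where M: "\<And>f g. (f, g) \<in> maximal_op T \<Longrightarrow>
        ell2_norm f \<le> M * ell2_norm (\<lambda>k. g k - z * f k)"
      unfolding resolvent_set_def gen by blast
    obtain v where v: "v \<in> finitely_supported"
      "ell2_norm v > M * ell2_norm (\<lambda>i. (\<Sum>j. T i j * v j) - z * v i)"
      using shifted_darboux_not_bounded_below[OF F refl assms(3)] unfolding T_def by blast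
    show False using M[OF finitely_supported_maximal_op[OF T v(1)]] v(2) by linarith
  qed
  then have "resolvent_set (generated_op T) = {}" by blast
  with sa show ?thesis
    unfolding op_spectrum_def definitizable_def Let_def T_def[symmetric] by simp
qed

end
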